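(* Let $\nabla$ and $\nabla^*$ be dual connections on a (pseudo-)Riemannian manifold $(M,g)$, let $\alpha\in\mathbb R$, and let $R^{(\alpha)}$ be the curvature tensor of the $\alpha$-connection $\nabla^{(\alpha)}=\frac{1+\alpha}{2}\nabla+\frac{1-\alpha}{2}\nabla^*$. Then for all vector fields $X,Y,Z$ on $M$, $$R^{(\alpha)}(X,Y)Z=\frac{1+\alpha}{2}R(X,Y)Z+\frac{1-\alpha}{2}R^*(X,Y)Z+\frac{1-\alpha^2}{4}\Big\{K(Y,K(X,Z))-K(X,K(Y,Z))\Big\}.$$
   Context: Connections are affine connections, possibly with torsion. $\nabla$ and $\nabla^*$ are ($g$-)dual if $X(g(Y,Z))=g(\nabla_XY,Z)+g(Y,\nabla^*_XZ)$ for all vector fields. The difference tensor is $K(X,Y)=\nabla^*_XY-\nabla_XY$. The curvature of a connection is $R(X,Y)Z=\nabla_X\nabla_YZ-\nabla_Y\nabla_XZ-\nabla_{[X,Y]}Z$; $R$, $R^*$, $R^{(\alpha)}$ are the curvatures of $\nabla$, $\nabla^*$, $\nabla^{(\alpha)}$. *)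

theory Defs
  imports "HOL-Analysis.Analysis"
begin

section \<open>Smooth manifolds\<close>

text \<open>\<open>C\<^sup>k\<close> maps on an open subset of a Euclidean space: a map is \<open>C\<^sup>k\<^sup>+\<^sup>1\<close> if it is
  differentiable and all its directional derivatives are \<open>C\<^sup>k\<close>.\<close>

primrec C_k_on ::
  "nat \<Rightarrow> 'e::euclidean_space set \<Rightarrow> ('e \<Rightarrow> 'f::real_normed_vector) \<Rightarrow> bool" where
  "C_k_on 0 S f \<longleftrightarrow> continuous_on S f"
| "C_k_on (Suc k) S f \<longleftrightarrow>
     (\<forall>x\<in>S. f differentiable (at x)) \<and>
     (\<forall>v. C_k_on k S (\<lambda>x. frechet_derivative f (at x) v))"

definition smooth_on ::
  "'e::euclidean_space set \<Rightarrow> ('e \<Rightarrow> 'f::real_normed_vector) \<Rightarrow> bool" where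
  "smooth_on S f \<longleftrightarrow> (\<forall>k. C_k_on k S f)"

type_synonym ('a, 'e) chart = "'a set \<times> ('a \<Rightarrow> 'e)"

definition is_chart :: "'a topology \<Rightarrow> ('a, 'e::euclidean_space) chart \<Rightarrow> bool" where
  "is_chart T c \<longleftrightarrow> (case c of (U, \<phi>) \<Rightarrow>
     openin T U \<and> open (\<phi> ` U) \<and>
     homeomorphic_map (subtopology T U) (top_of_set (\<phi> ` U)) \<phi>)"

definition smoothly_compatible ::
  "('a, 'e::euclidean_space) chart \<Rightarrow> ('a, 'e) chart \<Rightarrow> bool" where
  "smoothly_compatible c d \<longleftrightarrow> (case (c, d) of ((U, \<phi>), (V, \<psi>)) \<Rightarrow>
     smooth_on (\<phi> ` (U \<inter> V)) (\<psi> \<circ> inv_into U \<phi>) \<and>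
     smooth_on (\<psi> ` (U \<inter> V)) (\<phi> \<circ> inv_into V \<psi>))"

text \<open>The carrier is the union of the chart domains, so the differential-geometric notions below
  depend on the atlas only; it need not be maximal.\<close>

definition mcarrier :: "('a, 'e::euclidean_space) chart set \<Rightarrow> 'a set" where
  "mcarrier A = (\<Union>(U, \<phi>)\<in>A. U)"

definition smooth_manifold ::
  "'a topology \<Rightarrow> ('a, 'e::euclidean_space) chart set \<Rightarrow> bool" where
  "smooth_manifold T A \<longleftrightarrow>
     Hausdorff_space T \<and> second_countable T \<and>
     topspace T = mcarrier A \<and>
     (\<forall>c\<in>A. is_chart T c) \<and>
     (\<forall>c\<in>A. \<forall>d\<in>A. smoothly_compatible c d)"

text \<open>Real-valued smooth functions. Values outside the carrier are unconstrained.\<close>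

definition smooth_functions ::
  "('a, 'e::euclidean_space) chart set \<Rightarrow> ('a \<Rightarrow> real) set" where
  "smooth_functions A = {f. \<forall>(U, \<phi>)\<in>A. smooth_on (\<phi> ` U) (f \<circ> inv_into U \<phi>)}"

section \<open>Tangent vectors and vector fields\<close>

text \<open>A tangent vector at a point \<open>p\<close> is a derivation at \<open>p\<close> of the algebra of smooth functions. The
  Leibniz rule already forces it to vanish on functions that are zero on the carrier, so it does not
  see the unconstrained values outside. It is set to zero on non-smooth functions, and a vector
  field is set to zero outside the carrier, so that both are determined by their meaningful
  values and can be compared with HOL equality. A vector field is smooth if it maps smooth functions
  to smooth functions.\<close>

type_synonym 'a tangent_vector = "('a \<Rightarrow> real) \<Rightarrow> real"
type_synonym 'a vfield = "'a \<Rightarrow> 'a tangent_vector"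

definition tangent_space ::
  "('a, 'e::euclidean_space) chart set \<Rightarrow> 'a \<Rightarrow> 'a tangent_vector set" where
  "tangent_space A p = {v.
     (\<forall>a b. \<forall>f\<in>smooth_functions A. \<forall>h\<in>smooth_functions A.
        v (\<lambda>x. a * f x + b * h x) = a * v f + b * v h) \<and>
     (\<forall>f\<in>smooth_functions A. \<forall>h\<in>smooth_functions A.
        v (\<lambda>x. f x * h x) = f p * v h + h p * v f) \<and>
     (\<forall>f. f \<notin> smooth_functions A \<longrightarrow> v f = 0)}"

definition vf_apply :: "'a vfield \<Rightarrow> ('a \<Rightarrow> real) \<Rightarrow> 'a \<Rightarrow> real" where
  "vf_apply X f = (\<lambda>p. X p f)"

definition vector_fields ::
  "('a, 'e::euclidean_space) chart set \<Rightarrow> 'a vfield set" where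
  "vector_fields A = {X.
     (\<forall>p\<in>mcarrier A. X p \<in> tangent_space A p) \<and>
     (\<forall>p. p \<notin> mcarrier A \<longrightarrow> X p = (\<lambda>f. 0)) \<and>
     (\<forall>f\<in>smooth_functions A. vf_apply X f \<in> smooth_functions A)}"

definition vf_add :: "'a vfield \<Rightarrow> 'a vfield \<Rightarrow> 'a vfield" (infixl "+\<^sub>V" 65) where
  "X +\<^sub>V Y = (\<lambda>p f. X p f + Y p f)"

definition vf_diff :: "'a vfield \<Rightarrow> 'a vfield \<Rightarrow> 'a vfield" (infixl "-\<^sub>V" 65) where
  "X -\<^sub>V Y = (\<lambda>p f. X p f - Y p f)"

definition vf_scaleR :: "real \<Rightarrow> 'a vfield \<Rightarrow> 'a vfield" (infixr "*\<^sub>V" 75) where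
  "c *\<^sub>V X = (\<lambda>p f. c * X p f)"

definition vf_mult :: "('a \<Rightarrow> real) \<Rightarrow> 'a vfield \<Rightarrow> 'a vfield" (infixr "\<cdot>\<^sub>V" 75) where
  "h \<cdot>\<^sub>V X = (\<lambda>p f. h p * X p f)"

definition lie_bracket :: "'a vfield \<Rightarrow> 'a vfield \<Rightarrow> 'a vfield" where
  "lie_bracket X Y = (\<lambda>p f. X p (vf_apply Y f) - Y p (vf_apply X f))"

section \<open>Pseudo-Riemannian metrics\<close>

type_synonym 'a metric_tensor = "'a \<Rightarrow> 'a tangent_vector \<Rightarrow> 'a tangent_vector \<Rightarrow> real"

definition metric_apply ::
  "'a metric_tensor \<Rightarrow> 'a vfield \<Rightarrow> 'a vfield \<Rightarrow> 'a \<Rightarrow> real" where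
  "metric_apply g X Y = (\<lambda>p. g p (X p) (Y p))"

text \<open>No definiteness is imposed, so Riemannian metrics are included. Linearity in the second
  argument follows by symmetry.\<close>

definition pseudo_riemannian_metric ::
  "('a, 'e::euclidean_space) chart set \<Rightarrow> 'a metric_tensor \<Rightarrow> bool" where
  "pseudo_riemannian_metric A g \<longleftrightarrow>
     (\<forall>p\<in>mcarrier A.
        (\<forall>u\<in>tangent_space A p. \<forall>v\<in>tangent_space A p. g p u v = g p v u) \<and>
        (\<forall>a b. \<forall>u\<in>tangent_space A p. \<forall>v\<in>tangent_space A p. \<forall>w\<in>tangent_space A p.
           g p (\<lambda>f. a * u f + b * v f) w = a * g p u w + b * g p v w) \<and>
        (\<forall>u\<in>tangent_space A p.
           (\<forall>w\<in>tangent_space A p. g p u w = 0) \<longrightarrow> u = (\<lambda>f. 0))) \<and>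
     (\<forall>X\<in>vector_fields A. \<forall>Y\<in>vector_fields A. metric_apply g X Y \<in> smooth_functions A)"

definition pseudo_riemannian_manifold ::
  "'a topology \<Rightarrow> ('a, 'e::euclidean_space) chart set \<Rightarrow> 'a metric_tensor \<Rightarrow> bool" where
  "pseudo_riemannian_manifold T A g \<longleftrightarrow> smooth_manifold T A \<and> pseudo_riemannian_metric A g"

section \<open>Affine connections\<close>

type_synonym 'a connection = "'a vfield \<Rightarrow> 'a vfield \<Rightarrow> 'a vfield"

definition affine_connection ::
  "('a, 'e::euclidean_space) chart set \<Rightarrow> 'a connection \<Rightarrow> bool" where
  "affine_connection A D \<longleftrightarrow>
     (\<forall>X\<in>vector_fields A. \<forall>Y\<in>vector_fields A. D X Y \<in> vector_fields A) \<and>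
     (\<forall>f\<in>smooth_functions A. \<forall>h\<in>smooth_functions A.
        \<forall>X\<in>vector_fields A. \<forall>Y\<in>vector_fields A. \<forall>Z\<in>vector_fields A.
        D (f \<cdot>\<^sub>V X +\<^sub>V h \<cdot>\<^sub>V Y) Z = f \<cdot>\<^sub>V D X Z +\<^sub>V h \<cdot>\<^sub>V D Y Z) \<and>
     (\<forall>a b. \<forall>X\<in>vector_fields A. \<forall>Y\<in>vector_fields A. \<forall>Z\<in>vector_fields A.
        D X (a *\<^sub>V Y +\<^sub>V b *\<^sub>V Z) = a *\<^sub>V D X Y +\<^sub>V b *\<^sub>V D X Z) \<and>
     (\<forall>f\<in>smooth_functions A. \<forall>X\<in>vector_fields A. \<forall>Y\<in>vector_fields A.
        D X (f \<cdot>\<^sub>V Y) = vf_apply X f \<cdot>\<^sub>V Y +\<^sub>V f \<cdot>\<^sub>V D X Y)"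

definition dual_connections ::
  "('a, 'e::euclidean_space) chart set \<Rightarrow> 'a metric_tensor \<Rightarrow> 'a connection \<Rightarrow> 'a connection
   \<Rightarrow> bool" where
  "dual_connections A g D D' \<longleftrightarrow>
     (\<forall>X\<in>vector_fields A. \<forall>Y\<in>vector_fields A. \<forall>Z\<in>vector_fields A. \<forall>p\<in>mcarrier A.
        vf_apply X (metric_apply g Y Z) p =
          metric_apply g (D X Y) Z p + metric_apply g Y (D' X Z) p)"

definition difference_tensor :: "'a connection \<Rightarrow> 'a connection \<Rightarrow> 'a connection" where
  "difference_tensor D D' X Y = D' X Y -\<^sub>V D X Y"

definition alpha_connection ::
  "real \<Rightarrow> 'a connection \<Rightarrow> 'a connection \<Rightarrow> 'a connection" where
  "alpha_connection \<alpha> D D' X Y = ((1 + \<alpha>) / 2) *\<^sub>V D X Y +\<^sub>V ((1 - \<alpha>) / 2) *\<^sub>V D' X Y"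

definition curvature ::
  "'a connection \<Rightarrow> 'a vfield \<Rightarrow> 'a vfield \<Rightarrow> 'a vfield \<Rightarrow> 'a vfield" where
  "curvature D X Y Z = D X (D Y Z) -\<^sub>V D Y (D X Z) -\<^sub>V D (lie_bracket X Y) Z"

end

theory Submission
  imports Defs
begin

text \<open>
  Put \<open>a = (1 + \<alpha>) / 2\<close> and \<open>b = (1 - \<alpha>) / 2\<close>, so that \<open>a + b = 1\<close> and
  \<open>a * b = (1 - \<alpha>\<^sup>2) / 4\<close>. For fixed \<open>X\<close> and \<open>Y\<close> write the covariant derivatives as linear
  operators on vector fields. For linear operators the convex-combination defect
  \<open>a P Q + b P' Q' - (a P + b P') (a Q + b Q') = a b (P' - P) (Q' - Q)\<close>
  follows from \<open>a - a\<^sup>2 = b - b\<^sup>2 = a b\<close>. With \<open>P = \<nabla>\<^sub>X\<close>, \<open>Q = \<nabla>\<^sub>Y\<close> and the primed operators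
  from the other connection, the right-hand side is \<open>a b K(X, K(Y, \<cdot>))\<close>; this is
  \<open>alpha_connection_compose\<close>. Antisymmetrizing in \<open>X\<close> and \<open>Y\<close> turns the second covariant
  derivatives into curvatures and the defect into the commutator of the operators
  \<open>K(X, \<cdot>)\<close> and \<open>K(Y, \<cdot>)\<close>. The term with the Lie bracket is of first order in the connection
  and has no defect.
\<close>

lemma affine_connection_linear:
  assumes "affine_connection A D"
    and "X \<in> vector_fields A" "Y \<in> vector_fields A" "Z \<in> vector_fields A"
  shows "D X (a *\<^sub>V Y +\<^sub>V b *\<^sub>V Z) = a *\<^sub>V D X Y +\<^sub>V b *\<^sub>V D X Z"
  using assms unfolding affine_connection_def by blast

lemma affine_connection_diff:
  assumes "affine_connection A D"
    and "X \<in> vector_fields A" "Y \<in> vector_fields A" "Z \<in> vector_fields A"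
  shows "D X (Y -\<^sub>V Z) = D X Y -\<^sub>V D X Z"
proof -
  have diff_as_combination: "U -\<^sub>V W = 1 *\<^sub>V U +\<^sub>V (-1) *\<^sub>V W" for U W :: "'a vfield"
    by (simp add: vf_diff_def vf_add_def vf_scaleR_def)
  show ?thesis
    using affine_connection_linear[OF assms] by (simp only: diff_as_combination)
qed

lemma affine_connection_closed:
  assumes "affine_connection A D" "X \<in> vector_fields A" "Y \<in> vector_fields A"
  shows "D X Y \<in> vector_fields A"
  using assms unfolding affine_connection_def by blast

text \<open>The second covariant derivative of the \<open>\<alpha>\<close>-connection misses the corresponding combination of
  second covariant derivatives by a term quadratic in the difference tensor. Expanding both sides
  by linearity gives the mixed terms \<open>D X (D' Y Z)\<close> and \<open>D' X (D Y Z)\<close> the same coefficient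
  \<open>(1 - \<alpha>\<^sup>2) / 4\<close>, and the coefficients of the pure terms agree because
  \<open>((1 \<plusminus> \<alpha>) / 2)\<^sup>2 = (1 \<plusminus> \<alpha>) / 2 - (1 - \<alpha>\<^sup>2) / 4\<close>.\<close>

lemma alpha_connection_compose:
  assumes D: "affine_connection A D" and D': "affine_connection A D'"
    and X: "X \<in> vector_fields A" and Y: "Y \<in> vector_fields A" and Z: "Z \<in> vector_fields A"
  shows "alpha_connection \<alpha> D D' X (alpha_connection \<alpha> D D' Y Z) =
           ((1 + \<alpha>) / 2) *\<^sub>V D X (D Y Z) +\<^sub>V ((1 - \<alpha>) / 2) *\<^sub>V D' X (D' Y Z)
           -\<^sub>V ((1 - \<alpha>\<^sup>2) / 4) *\<^sub>V
             difference_tensor D D' X (difference_tensor D D' Y Z)"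
proof -
  have YZ: "D Y Z \<in> vector_fields A" "D' Y Z \<in> vector_fields A"
    using affine_connection_closed D D' Y Z by blast+
  note expand = affine_connection_linear[OF D X YZ] affine_connection_linear[OF D' X YZ]
    affine_connection_diff[OF D X YZ(2) YZ(1)] affine_connection_diff[OF D' X YZ(2) YZ(1)]
  show ?thesis
    unfolding alpha_connection_def difference_tensor_def expand
    by (intro ext) (simp add: vf_add_def vf_diff_def vf_scaleR_def field_simps power2_eq_square)
qed

theorem curvature_alpha_connection:
  assumes "affine_connection A D" "affine_connection A D'"
    and "X \<in> vector_fields A" "Y \<in> vector_fields A" "Z \<in> vector_fields A"
  defines "K \<equiv> difference_tensor D D'"
  shows "curvature (alpha_connection \<alpha> D D') X Y Z =
           ((1 + \<alpha>) / 2) *\<^sub>V curvature D X Y Z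
           +\<^sub>V ((1 - \<alpha>) / 2) *\<^sub>V curvature D' X Y Z
           +\<^sub>V ((1 - \<alpha>\<^sup>2) / 4) *\<^sub>V (K Y (K X Z) -\<^sub>V K X (K Y Z))"
proof -
  have bracket: "alpha_connection \<alpha> D D' (lie_bracket X Y) Z =
      ((1 + \<alpha>) / 2) *\<^sub>V D (lie_bracket X Y) Z +\<^sub>V ((1 - \<alpha>) / 2) *\<^sub>V D' (lie_bracket X Y) Z"
    by (simp only: alpha_connection_def)
  show ?thesis
    unfolding curvature_def bracket K_def
      alpha_connection_compose[OF assms(1-5)]
      alpha_connection_compose[OF assms(1,2,4,3,5)]
    by (intro ext) (simp add: vf_add_def vf_diff_def vf_scaleR_def algebra_simps)
qed

theorem proposition6p6:
  fixes T :: "'a topology"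
    and A :: "('a, 'e::euclidean_space) chart set"
    and g :: "'a metric_tensor"
    and D D' :: "'a connection"
    and \<alpha> :: real
    and X Y Z :: "'a vfield"
  assumes "pseudo_riemannian_manifold T A g"
    and "affine_connection A D"
    and "affine_connection A D'"
    and "dual_connections A g D D'"
    and "X \<in> vector_fields A"
    and "Y \<in> vector_fields A"
    and "Z \<in> vector_fields A"
  defines "K \<equiv> difference_tensor D D'"
  shows "curvature (alpha_connection \<alpha> D D') X Y Z =
           ((1 + \<alpha>) / 2) *\<^sub>V curvature D X Y Z
           +\<^sub>V ((1 - \<alpha>) / 2) *\<^sub>V curvature D' X Y Z
           +\<^sub>V ((1 - \<alpha>\<^sup>2) / 4) *\<^sub>V (K Y (K X Z) -\<^sub>V K X (K Y Z))"
  unfolding K_def using assms(2,3,5-7) by (rule curvature_alpha_connection)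

end
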